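(* Let $\mathscr{C}$ be a directed category such that $\mathscr{C}(x, x)$ is finite for every $x \in \mathrm{Ob}(\mathscr{C})$. Then every Grothendieck topology on $\mathscr{C}^{\mathrm{op}}$ is rigid if and only if $\mathscr{C}$ is a noetherian EI category; that is, the poset $(\mathrm{Ob}(\mathscr{C}), \leqslant)$ satisfies the ascending chain condition and every endomorphism in $\mathscr{C}$ is an isomorphism.
   Context: For a small skeletal category $\mathscr{C}$ write $x \leqslant y$ if $\mathscr{C}(x,y) \neq \emptyset$. $\mathscr{C}$ is directed if it is small, skeletal, and $\leqslant$ is a partial order on $\mathrm{Ob}(\mathscr{C})$. A sieve on $x$ in $\mathscr{C}^{\mathrm{op}}$ is a subfunctor $S \subseteq \mathscr{C}(x,-)$ (possibly empty), i.e. a set of morphisms of $\mathscr{C}$ with domain $x$ closed under post-composition. For $f: x \to y$ put $f^{\ast}(S) = \{ g: y \to \bullet \mid gf \in S\}$. A Grothendieck topology $J$ on $\mathscr{C}^{\mathrm{op}}$ assigns to each object $x$ a collection $J(x)$ of subfunctors of $\mathscr{C}(x,-)$ such that: $\mathscr{C}(x,-) \in J(x)$; $S \in J(x)$ implies $f^{\ast}(S) \in J(y)$ for every $f: x \to y$; and if $S \in J(x)$ and $T \subseteq \mathscr{C}(x,-)$ is a subfunctor with $f^{\ast}(T) \in J(y)$ for every $(f: x \to y) \in S$, then $T \in J(x)$. An object $x$ is $J$-irreducible if $J(x) = \{\mathscr{C}(x,-)\}$. For an object $y$ let $S_y \subseteq \mathscr{C}(y,-)$ be the subfunctor generated by all morphisms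 of $\mathscr{C}$ from $y$ to $J$-irreducible objects: $S_y = \bigcup_{x\ J\text{-irreducible}} \{ f \circ g \mid g \in \mathscr{C}(y,x),\ f \in \mathscr{C}(x,-)\}$. $J$ is rigid (also called a subcategory topology) if $S_y \in J(y)$ for every object $y$. *)

theory Defs
  imports Main
begin

text \<open>
  A small category is given by a set of objects and a single set of morphisms with domain and
  codomain maps. \<open>Comp C g f\<close> is the composite of \<open>f\<close> followed by \<open>g\<close>; it is constrained only
  when \<open>Cod C f = Dom C g\<close>. Objects and morphisms form sets, so smallness is built in.
\<close>

record ('o, 'm) small_cat =
  Ob :: "'o set"
  Mor :: "'m set"
  Dom :: "'m \<Rightarrow> 'o"
  Cod :: "'m \<Rightarrow> 'o"
  Ident :: "'o \<Rightarrow> 'm"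
  Comp :: "'m \<Rightarrow> 'm \<Rightarrow> 'm"

definition Hom :: "('o, 'm) small_cat \<Rightarrow> 'o \<Rightarrow> 'o \<Rightarrow> 'm set" where
  "Hom C x y = {f \<in> Mor C. Dom C f = x \<and> Cod C f = y}"

locale category =
  fixes C :: "('o, 'm) small_cat"
  assumes Dom_in_Ob: "f \<in> Mor C \<Longrightarrow> Dom C f \<in> Ob C"
    and Cod_in_Ob: "f \<in> Mor C \<Longrightarrow> Cod C f \<in> Ob C"
    and Ident_in_Hom: "x \<in> Ob C \<Longrightarrow> Ident C x \<in> Hom C x x"
    and Comp_in_Hom: "f \<in> Hom C x y \<Longrightarrow> g \<in> Hom C y z \<Longrightarrow> Comp C g f \<in> Hom C x z"
    and Comp_Ident_right: "f \<in> Hom C x y \<Longrightarrow> Comp C f (Ident C x) = f"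
    and Comp_Ident_left: "f \<in> Hom C x y \<Longrightarrow> Comp C (Ident C y) f = f"
    and Comp_assoc: "f \<in> Hom C w x \<Longrightarrow> g \<in> Hom C x y \<Longrightarrow> h \<in> Hom C y z \<Longrightarrow>
      Comp C (Comp C h g) f = Comp C h (Comp C g f)"

definition isomorphism :: "('o, 'm) small_cat \<Rightarrow> 'o \<Rightarrow> 'o \<Rightarrow> 'm \<Rightarrow> bool" where
  "isomorphism C x y f \<longleftrightarrow> f \<in> Hom C x y \<and>
     (\<exists>g \<in> Hom C y x. Comp C g f = Ident C x \<and> Comp C f g = Ident C y)"

definition skeletal :: "('o, 'm) small_cat \<Rightarrow> bool" where
  "skeletal C \<longleftrightarrow> (\<forall>x \<in> Ob C. \<forall>y \<in> Ob C. (\<exists>f. isomorphism C x y f) \<longrightarrow> x = y)"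

definition ob_le :: "('o, 'm) small_cat \<Rightarrow> 'o rel" where
  "ob_le C = {(x, y). x \<in> Ob C \<and> y \<in> Ob C \<and> Hom C x y \<noteq> {}}"

definition directed_category :: "('o, 'm) small_cat \<Rightarrow> bool" where
  "directed_category C \<longleftrightarrow> category C \<and> skeletal C \<and> partial_order_on (Ob C) (ob_le C)"

definition ascending_chain_condition :: "'a set \<Rightarrow> 'a rel \<Rightarrow> bool" where
  "ascending_chain_condition A r \<longleftrightarrow>
     (\<forall>c :: nat \<Rightarrow> 'a. (\<forall>n. c n \<in> A) \<and> (\<forall>n. (c n, c (Suc n)) \<in> r) \<longrightarrow>
        (\<exists>N. \<forall>n\<ge>N. c n = c N))"

definition EI :: "('o, 'm) small_cat \<Rightarrow> bool" where
  "EI C \<longleftrightarrow> (\<forall>x \<in> Ob C. \<forall>f \<in> Hom C x x. isomorphism C x x f)"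

definition noetherian_EI :: "('o, 'm) small_cat \<Rightarrow> bool" where
  "noetherian_EI C \<longleftrightarrow> ascending_chain_condition (Ob C) (ob_le C) \<and> EI C"

text \<open>
  Sieves and topologies below are those of the opposite category \<open>C\<^sup>o\<^sup>p\<close>, written out in \<open>C\<close>:
  \<open>Hom_from C x\<close> is the functor \<open>C(x, -)\<close>, and its subfunctors are identified with their sets of
  elements, i.e. sets of morphisms with domain \<open>x\<close> closed under post-composition.
\<close>

definition Hom_from :: "('o, 'm) small_cat \<Rightarrow> 'o \<Rightarrow> 'm set" where
  "Hom_from C x = {f \<in> Mor C. Dom C f = x}"

definition subfunctor :: "('o, 'm) small_cat \<Rightarrow> 'o \<Rightarrow> 'm set \<Rightarrow> bool" where
  "subfunctor C x S \<longleftrightarrow> S \<subseteq> Hom_from C x \<and>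
     (\<forall>f \<in> S. \<forall>g \<in> Hom_from C (Cod C f). Comp C g f \<in> S)"

definition pullback :: "('o, 'm) small_cat \<Rightarrow> 'm \<Rightarrow> 'm set \<Rightarrow> 'm set" where
  "pullback C f S = {g \<in> Hom_from C (Cod C f). Comp C g f \<in> S}"

text \<open>The values of \<open>J\<close> outside \<open>Ob C\<close> are unconstrained and never used.\<close>

definition grothendieck_topology :: "('o, 'm) small_cat \<Rightarrow> ('o \<Rightarrow> 'm set set) \<Rightarrow> bool" where
  "grothendieck_topology C J \<longleftrightarrow>
     (\<forall>x \<in> Ob C. \<forall>S \<in> J x. subfunctor C x S) \<and>
     (\<forall>x \<in> Ob C. Hom_from C x \<in> J x) \<and>
     (\<forall>x \<in> Ob C. \<forall>S \<in> J x. \<forall>y \<in> Ob C. \<forall>f \<in> Hom C x y. pullback C f S \<in> J y) \<and>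
     (\<forall>x \<in> Ob C. \<forall>S \<in> J x. \<forall>T. subfunctor C x T \<and>
        (\<forall>f \<in> S. pullback C f T \<in> J (Cod C f)) \<longrightarrow> T \<in> J x)"

definition irreducible_ob :: "('o, 'm) small_cat \<Rightarrow> ('o \<Rightarrow> 'm set set) \<Rightarrow> 'o \<Rightarrow> bool" where
  "irreducible_ob C J x \<longleftrightarrow> x \<in> Ob C \<and> J x = {Hom_from C x}"

definition irreducible_sieve ::
    "('o, 'm) small_cat \<Rightarrow> ('o \<Rightarrow> 'm set set) \<Rightarrow> 'o \<Rightarrow> 'm set" where
  "irreducible_sieve C J y =
     (\<Union>x \<in> {x. irreducible_ob C J x}. {Comp C f g | f g. g \<in> Hom C y x \<and> f \<in> Hom_from C x})"

definition rigid :: "('o, 'm) small_cat \<Rightarrow> ('o \<Rightarrow> 'm set set) \<Rightarrow> bool" where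
  "rigid C J \<longleftrightarrow> (\<forall>y \<in> Ob C. irreducible_sieve C J y \<in> J y)"

end

theory Submission
  imports Defs
begin

text \<open>
  If \<open>C\<close> is noetherian EI, rigidity follows by induction from the top of the poset: a proper sieve
  contains no isomorphism, hence all its members lead to strictly larger objects, where the
  irreducible sieve already covers.

  For the converse, consider a nonempty set \<open>P\<close> of objects such that every member of \<open>P\<close> is the
  source of a non-isomorphism into \<open>P\<close>; the object of a non-invertible endomorphism, or the
  members of a chain that does not stabilise, form such a set. Let \<open>S\<close> cover \<open>y\<close> if every
  \<open>g : y \<rightarrow> p\<close> with \<open>p \<in> P\<close> can be prolonged by a non-isomorphism into \<open>P\<close> to a member of \<open>S\<close>.
  Finiteness of the endomorphism monoids makes the non-isomorphisms a two-sided ideal, so this is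
  a topology in which the non-isomorphisms out of any object form a proper covering sieve.
  Hence nothing is irreducible, and rigidity would make the empty sieve cover the members of \<open>P\<close>.
\<close>

text \<open>Where no morphism from \<open>y\<close> into \<open>P\<close> exists, the condition is
  vacuous and even the empty sieve covers \<open>y\<close>. Over a member of \<open>P\<close> the
  identity is one of the \<open>g\<close> to be prolonged.\<close>

definition prolongation_topology ::
    "('o, 'm) small_cat \<Rightarrow> 'o set \<Rightarrow> 'o \<Rightarrow> 'm set set" where
  "prolongation_topology C P y = {S. subfunctor C y S \<and>
     (\<forall>p \<in> P. \<forall>g \<in> Hom C y p. \<exists>q \<in> P. \<exists>w \<in> Hom C p q.
        \<not> isomorphism C p q w \<and> Comp C w g \<in> S)}"

lemma ascending_chain_conditionD:
  assumes "ascending_chain_condition A r" "\<And>n. c n \<in> A" "\<And>n. (c n, c (Suc n)) \<in> r"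
  shows "\<exists>N. \<forall>n\<ge>N. c n = c N"
  using assms(1)[unfolded ascending_chain_condition_def, THEN spec[of _ c]] assms(2,3) by simp

section \<open>Hom-sets, sieves and pullbacks\<close>

context category
begin

lemma Hom_from_eq: "f \<in> Hom_from C x \<longleftrightarrow> f \<in> Hom C x (Cod C f)"
  by (auto simp: Hom_from_def Hom_def)

lemma Hom_imp_Hom_from: "f \<in> Hom C x y \<Longrightarrow> f \<in> Hom_from C x"
  by (auto simp: Hom_from_def Hom_def)

lemma Cod_Hom: "f \<in> Hom C x y \<Longrightarrow> Cod C f = y"
  by (auto simp: Hom_def)

lemma Hom_Ob: "f \<in> Hom C x y \<Longrightarrow> x \<in> Ob C" "f \<in> Hom C x y \<Longrightarrow> y \<in> Ob C"
  using Dom_in_Ob Cod_in_Ob by (auto simp: Hom_def)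

lemma isomorphism_Ident: "x \<in> Ob C \<Longrightarrow> isomorphism C x x (Ident C x)"
  unfolding isomorphism_def using Ident_in_Hom Comp_Ident_left by blast

lemma subfunctor_Hom_from: "subfunctor C x (Hom_from C x)"
  unfolding subfunctor_def by (meson Comp_in_Hom Hom_from_eq Hom_imp_Hom_from subset_refl)

lemma subfunctor_comp:
  "subfunctor C x S \<Longrightarrow> f \<in> S \<Longrightarrow> f \<in> Hom C x y \<Longrightarrow> g \<in> Hom C y z \<Longrightarrow> Comp C g f \<in> S"
  unfolding subfunctor_def by (metis Cod_Hom Hom_imp_Hom_from)

lemma subfunctor_mem_Hom: "subfunctor C x S \<Longrightarrow> f \<in> S \<Longrightarrow> f \<in> Hom C x (Cod C f)"
  unfolding subfunctor_def using Hom_from_eq by blast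

lemma mem_pullback:
  "f \<in> Hom C x y \<Longrightarrow> g \<in> Hom C y z \<Longrightarrow> g \<in> pullback C f S \<longleftrightarrow> Comp C g f \<in> S"
  unfolding pullback_def using Cod_Hom[of f x y] Hom_imp_Hom_from[of g y z] by simp

lemma subfunctor_pullback:
  assumes "f \<in> Hom C x y" "subfunctor C x S"
  shows "subfunctor C y (pullback C f S)"
proof -
  have "Comp C h g \<in> pullback C f S"
    if g: "g \<in> pullback C f S" and h: "h \<in> Hom_from C (Cod C g)" for g h
  proof -
    have g': "g \<in> Hom C y (Cod C g)" and gf: "Comp C g f \<in> S"
      using g Cod_Hom[OF assms(1)] Hom_from_eq[of g] by (auto simp: pullback_def)
    have h': "h \<in> Hom C (Cod C g) (Cod C h)"
      using h Hom_from_eq by blast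
    have "Comp C h (Comp C g f) \<in> S"
      using subfunctor_comp[OF assms(2) gf Comp_in_Hom[OF assms(1) g'] h'] .
    then show ?thesis
      using mem_pullback[OF assms(1) Comp_in_Hom[OF g' h']] Comp_assoc[OF assms(1) g' h'] by simp
  qed
  moreover have "pullback C f S \<subseteq> Hom_from C y"
    using Cod_Hom[OF assms(1)] by (auto simp: pullback_def)
  ultimately show ?thesis by (simp add: subfunctor_def)
qed

lemma pullback_member:
  assumes "subfunctor C x S" "f \<in> S" "f \<in> Hom C x y"
  shows "pullback C f S = Hom_from C y"
  using subfunctor_comp[OF assms] Cod_Hom[OF assms(3)]
  by (auto simp: pullback_def Hom_from_eq)

text \<open>Composing an isomorphism with its inverse puts the identity into the sieve, and a sieve
  containing the identity is maximal.\<close>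

lemma proper_subfunctor_no_isomorphism:
  assumes S: "subfunctor C x S" and "S \<noteq> Hom_from C x" and "f \<in> S"
  shows "\<not> isomorphism C x y f"
proof
  assume "isomorphism C x y f"
  then obtain g where f: "f \<in> Hom C x y" and g: "g \<in> Hom C y x" "Comp C g f = Ident C x"
    by (auto simp: isomorphism_def)
  then have id: "Ident C x \<in> S"
    using subfunctor_comp[OF S \<open>f \<in> S\<close>] by metis
  have "h \<in> S" if "h \<in> Hom_from C x" for h
    using that subfunctor_comp[OF S id Ident_in_Hom] Comp_Ident_right
    by (metis Hom_Ob(1) Hom_from_eq)
  then show False
    using S \<open>S \<noteq> Hom_from C x\<close> by (auto simp: subfunctor_def)
qed

section \<open>Covering sieves and the irreducible sieve\<close>

lemma topology_transitive:
  assumes "grothendieck_topology C J" "x \<in> Ob C" "S \<in> J x" "subfunctor C x T"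
    and "\<And>f. f \<in> S \<Longrightarrow> pullback C f T \<in> J (Cod C f)"
  shows "T \<in> J x"
  using assms unfolding grothendieck_topology_def by blast

text \<open>Pulling \<open>T\<close> back along a member of \<open>S\<close> gives the maximal
  sieve, which covers, so transitivity along \<open>S\<close> applies.\<close>

lemma topology_upward_closed:
  assumes J: "grothendieck_topology C J" and "x \<in> Ob C" "S \<in> J x" "S \<subseteq> T" "subfunctor C x T"
  shows "T \<in> J x"
proof -
  have S: "subfunctor C x S"
    using J assms(2,3) by (auto simp: grothendieck_topology_def)
  have "pullback C f T \<in> J (Cod C f)" if "f \<in> S" for f
  proof -
    have f: "f \<in> Hom C x (Cod C f)"
      using subfunctor_mem_Hom[OF S that] .
    then have "pullback C f T = Hom_from C (Cod C f)"
      using pullback_member[OF assms(5)] assms(4) that by blast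
    then show ?thesis
      using J Hom_Ob(2)[OF f] by (simp add: grothendieck_topology_def)
  qed
  then show ?thesis
    using topology_transitive[OF J assms(2,3,5)] by blast
qed

lemma mem_irreducible_sieve:
  "h \<in> irreducible_sieve C J y \<longleftrightarrow>
    (\<exists>x g f. irreducible_ob C J x \<and> g \<in> Hom C y x \<and> f \<in> Hom C x (Cod C f) \<and> h = Comp C f g)"
  unfolding irreducible_sieve_def using Hom_from_eq by blast

lemma subfunctor_irreducible_sieve: "subfunctor C y (irreducible_sieve C J y)"
proof -
  have "h \<in> Hom_from C y \<and> (\<forall>k \<in> Hom_from C (Cod C h). Comp C k h \<in> irreducible_sieve C J y)"
    if "h \<in> irreducible_sieve C J y" for h
  proof -
    obtain x g f where *: "irreducible_ob C J x" and g: "g \<in> Hom C y x"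
      and f: "f \<in> Hom C x (Cod C f)" and h: "h = Comp C f g"
      using \<open>h \<in> irreducible_sieve C J y\<close> mem_irreducible_sieve by blast
    have fg: "Comp C f g \<in> Hom C y (Cod C f)"
      using Comp_in_Hom[OF g f] .
    have "Comp C k h \<in> irreducible_sieve C J y" if "k \<in> Hom_from C (Cod C h)" for k
    proof -
      have k: "k \<in> Hom C (Cod C f) (Cod C k)"
        using that h Cod_Hom[OF fg] Hom_from_eq by metis
      have kf: "Comp C k f \<in> Hom C x (Cod C k)"
        using Comp_in_Hom[OF f k] .
      show ?thesis
        unfolding mem_irreducible_sieve
        using * g kf Cod_Hom[OF kf] h Comp_assoc[OF g f k] by metis
    qed
    then show ?thesis using fg h Hom_imp_Hom_from by blast
  qed
  then show ?thesis by (auto simp: subfunctor_def)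
qed

text \<open>Precomposition with \<open>f\<close> preserves factoring through an irreducible object.
  With upward closure, a covering irreducible sieve at \<open>z\<close> yields a covering
  pullback.\<close>

lemma irreducible_sieve_subset_pullback:
  assumes "f \<in> Hom C y z"
  shows "irreducible_sieve C J z \<subseteq> pullback C f (irreducible_sieve C J y)"
proof
  fix h assume "h \<in> irreducible_sieve C J z"
  then obtain x g k where *: "irreducible_ob C J x" and g: "g \<in> Hom C z x"
    and k: "k \<in> Hom C x (Cod C k)" and h: "h = Comp C k g"
    using mem_irreducible_sieve by blast
  have "Comp C h f \<in> irreducible_sieve C J y"
    unfolding mem_irreducible_sieve h
    using * k Comp_in_Hom[OF assms g] Comp_assoc[OF assms g k] by blast
  then show "h \<in> pullback C f (irreducible_sieve C J y)"
    using mem_pullback[OF assms Comp_in_Hom[OF g k]] h by simp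
qed

text \<open>The identity of \<open>y\<close> factors through the irreducible object \<open>y\<close>
  itself, and a proper sieve contains no isomorphism.\<close>

lemma irreducible_sieve_of_irreducible:
  assumes "irreducible_ob C J y"
  shows "irreducible_sieve C J y = Hom_from C y"
proof (rule ccontr)
  assume "irreducible_sieve C J y \<noteq> Hom_from C y"
  moreover have y: "y \<in> Ob C"
    using assms by (simp add: irreducible_ob_def)
  moreover have "Ident C y \<in> irreducible_sieve C J y"
    unfolding mem_irreducible_sieve
    using assms Ident_in_Hom[OF y] Cod_Hom Comp_Ident_left by metis
  ultimately show False
    using proper_subfunctor_no_isomorphism[OF subfunctor_irreducible_sieve] isomorphism_Ident
    by blast
qed

section \<open>Noetherian EI implies rigid\<close>

lemma rigid_of_noetherian_EI:
  assumes N: "noetherian_EI C" and J: "grothendieck_topology C J"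
  shows "rigid C J"
proof -
  \<comment> \<open>Larger objects come first in \<open>?r\<close>, so the induction starts at the
    top; an infinite descent in \<open>?r\<close> is a strictly ascending chain.\<close>
  let ?r = "{(z, y). (y, z) \<in> ob_le C \<and> z \<noteq> y}"
  have "wf ?r"
    unfolding wf_iff_no_infinite_down_chain
  proof
    assume "\<exists>c. \<forall>i. (c (Suc i), c i) \<in> ?r"
    then obtain c where c: "\<And>i. (c i, c (Suc i)) \<in> ob_le C" "\<And>i. c (Suc i) \<noteq> c i"
      by blast
    have ob: "c i \<in> Ob C" for i
      using c(1)[of i] by (simp add: ob_le_def)
    have acc: "ascending_chain_condition (Ob C) (ob_le C)"
      using N by (simp add: noetherian_EI_def)
    obtain N where "\<forall>n\<ge>N. c n = c N"
      using ascending_chain_conditionD[of _ _ c, OF acc ob c(1)] ..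
    then have "c (Suc N) = c N" by (blast intro: le_SucI)
    then show False using c(2) by blast
  qed
  then have "y \<in> Ob C \<longrightarrow> irreducible_sieve C J y \<in> J y" for y
  proof (induction y rule: wf_induct_rule)
    case (less y)
    show ?case
    proof
      assume y: "y \<in> Ob C"
      have max: "Hom_from C y \<in> J y"
        using J y by (simp add: grothendieck_topology_def)
      show "irreducible_sieve C J y \<in> J y"
      proof (cases "irreducible_ob C J y")
        case True
        then show ?thesis using irreducible_sieve_of_irreducible max by simp
      next
        case False
        \<comment> \<open>The maximal sieve always covers, so \<open>y\<close> can fail to be
          irreducible only through a proper covering sieve.\<close>
        then obtain S where S: "S \<in> J y" "S \<noteq> Hom_from C y"
          using y max by (auto simp: irreducible_ob_def)
        have sub: "subfunctor C y S"
          using J y S(1) by (simp add: grothendieck_topology_def)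
        have "pullback C f (irreducible_sieve C J y) \<in> J (Cod C f)" if "f \<in> S" for f
        proof -
          have f: "f \<in> Hom C y (Cod C f)"
            using subfunctor_mem_Hom[OF sub that] .
          have "Cod C f \<noteq> y"
          proof
            assume "Cod C f = y"
            then have "isomorphism C y y f"
              using N y f by (simp add: noetherian_EI_def EI_def)
            then show False
              using proper_subfunctor_no_isomorphism[OF sub S(2) that] by blast
          qed
          then have "(Cod C f, y) \<in> ?r"
            using f y Hom_Ob(2)[OF f] by (auto simp: ob_le_def)
          then have "irreducible_sieve C J (Cod C f) \<in> J (Cod C f)"
            using less.IH Hom_Ob(2)[OF f] by blast
          \<comment> \<open>The pulled-back sieve contains the irreducible sieve of the codomain,
            which covers by induction.\<close>
          then show ?thesis
            using topology_upward_closed[OF J Hom_Ob(2)[OF f]]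
              irreducible_sieve_subset_pullback[OF f]
              subfunctor_pullback[OF f subfunctor_irreducible_sieve] by blast
        qed
        then show ?thesis
          using topology_transitive[OF J y S(1) subfunctor_irreducible_sieve] by blast
      qed
    qed
  qed
  then show ?thesis by (simp add: rigid_def)
qed

section \<open>Isomorphisms and finite endomorphism monoids\<close>

lemma finite_End_left_inverse_imp_right_inverse:
  assumes fin: "finite (Hom C x x)" and a: "a \<in> Hom C x x" and b: "b \<in> Hom C x x"
    and ab: "Comp C a b = Ident C x"
  shows "Comp C b a = Ident C x"
proof -
  have x: "x \<in> Ob C" using Hom_Ob(1)[OF a] .
  have cancel: "Comp C a (Comp C b u) = u" if "u \<in> Hom C x x" for u
    using Comp_assoc[OF that b a] ab Comp_Ident_left[OF that] by simp
  \<comment> \<open>Composition with \<open>b\<close> has a left inverse, so on a finite monoid it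
    is surjective. A preimage of the identity is a right inverse of \<open>b\<close>, and
    cancellation identifies it with \<open>a\<close>.\<close>
  have "inj_on (Comp C b) (Hom C x x)"
    by (rule inj_on_inverseI) (rule cancel)
  moreover have "Comp C b ` Hom C x x \<subseteq> Hom C x x"
    using Comp_in_Hom[OF _ b] by blast
  ultimately have "Comp C b ` Hom C x x = Hom C x x"
    using fin by (simp add: endo_inj_surj)
  then obtain u where u: "u \<in> Hom C x x" "Comp C b u = Ident C x"
    using Ident_in_Hom[OF x] by (metis imageE)
  then have "u = a"
    using cancel[OF u(1)] Comp_Ident_right[OF a] by simp
  then show ?thesis using u(2) by simp
qed

end

text \<open>Skeletality gives \<open>z = x\<close>, and antisymmetry then gives
  \<open>y = x\<close>. So \<open>f\<close> and \<open>g\<close> are endomorphisms of one object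
  with one-sided inverses, which finiteness makes two-sided.\<close>

lemma directed_comp_isomorphismD:
  assumes dir: "directed_category C" and fin: "\<forall>x \<in> Ob C. finite (Hom C x x)"
    and f: "f \<in> Hom C x y" and g: "g \<in> Hom C y z" and iso: "isomorphism C x z (Comp C g f)"
  shows "isomorphism C x y f" "isomorphism C y z g"
proof -
  interpret category C using dir by (simp add: directed_category_def)
  have "x \<in> Ob C" "y \<in> Ob C" "z \<in> Ob C"
    using Hom_Ob f g by blast+
  then have zx: "z = x"
    using dir iso unfolding directed_category_def skeletal_def by blast
  have "(x, y) \<in> ob_le C" "(y, x) \<in> ob_le C"
    using \<open>x \<in> Ob C\<close> \<open>y \<in> Ob C\<close> f g zx by (auto simp: ob_le_def)
  moreover have "antisym (ob_le C)"
    using dir by (simp add: directed_category_def partial_order_on_def)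
  ultimately have yx: "y = x" by (auto dest: antisymD)
  have f': "f \<in> Hom C x x" and g': "g \<in> Hom C x x" and fx: "finite (Hom C x x)"
    using f g zx yx fin \<open>x \<in> Ob C\<close> by auto
  obtain k where k: "k \<in> Hom C x x" and kgf: "Comp C k (Comp C g f) = Ident C x"
    and gfk: "Comp C (Comp C g f) k = Ident C x"
    using iso zx by (auto simp: isomorphism_def)
  have kg: "Comp C k g \<in> Hom C x x" and fk: "Comp C f k \<in> Hom C x x"
    using Comp_in_Hom f' g' k by blast+
  have 1: "Comp C (Comp C k g) f = Ident C x"
    using Comp_assoc[OF f' g' k] kgf by simp
  have 2: "Comp C g (Comp C f k) = Ident C x"
    using Comp_assoc[OF k f' g'] gfk by simp
  show "isomorphism C x y f"
    unfolding isomorphism_def yx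
    using f' kg 1 finite_End_left_inverse_imp_right_inverse[OF fx kg f' 1] by blast
  show "isomorphism C y z g"
    unfolding isomorphism_def yx zx
    using g' fk 2 finite_End_left_inverse_imp_right_inverse[OF fx g' fk 2] by blast
qed

section \<open>The prolongation topology\<close>

lemma grothendieck_topology_prolongation:
  assumes dir: "directed_category C" and fin: "\<forall>x \<in> Ob C. finite (Hom C x x)"
    and P: "P \<subseteq> Ob C" "\<And>p. p \<in> P \<Longrightarrow> \<exists>q \<in> P. \<exists>w \<in> Hom C p q. \<not> isomorphism C p q w"
  shows "grothendieck_topology C (prolongation_topology C P)"
proof -
  interpret category C using dir by (simp add: directed_category_def)
  let ?J = "prolongation_topology C P"
  have max: "Hom_from C x \<in> ?J x" for x
  proof -
    have "\<exists>q \<in> P. \<exists>w \<in> Hom C p q. \<not> isomorphism C p q w \<and> Comp C w g \<in> Hom_from C x"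
      if "p \<in> P" "g \<in> Hom C x p" for p g
      using P(2)[OF that(1)] Comp_in_Hom[OF that(2)] Hom_imp_Hom_from by blast
    then show ?thesis
      by (simp add: prolongation_topology_def subfunctor_Hom_from)
  qed
  have pull: "pullback C f S \<in> ?J y" if S: "S \<in> ?J x" and f: "f \<in> Hom C x y" for x y S f
  proof -
    have "\<exists>q \<in> P. \<exists>w \<in> Hom C p q. \<not> isomorphism C p q w \<and> Comp C w g \<in> pullback C f S"
      if p: "p \<in> P" and g: "g \<in> Hom C y p" for p g
    proof -
      \<comment> \<open>The \<open>w\<close> that prolongs \<open>Comp C g f\<close> into
        \<open>S\<close> also prolongs \<open>g\<close> into the pullback.\<close>
      obtain q w where w: "q \<in> P" "w \<in> Hom C p q" "\<not> isomorphism C p q w"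
        and S': "Comp C w (Comp C g f) \<in> S"
        using S p Comp_in_Hom[OF f g] by (fastforce simp: prolongation_topology_def)
      have "Comp C w g \<in> pullback C f S"
        using S' mem_pullback[OF f Comp_in_Hom[OF g w(2)]] Comp_assoc[OF f g w(2)] by simp
      then show ?thesis using w by blast
    qed
    then show ?thesis
      using S subfunctor_pullback[OF f] by (simp add: prolongation_topology_def)
  qed
  have trans: "T \<in> ?J x"
    if S: "S \<in> ?J x" and T: "subfunctor C x T"
      and cov: "\<forall>f \<in> S. pullback C f T \<in> ?J (Cod C f)" for x S T
  proof -
    have "\<exists>r \<in> P. \<exists>u \<in> Hom C p r. \<not> isomorphism C p r u \<and> Comp C u g \<in> T"
      if p: "p \<in> P" and g: "g \<in> Hom C x p" for p g
    proof -
      obtain q w where q: "q \<in> P" and w: "w \<in> Hom C p q" "\<not> isomorphism C p q w"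
        and S': "Comp C w g \<in> S"
        using S p g by (fastforce simp: prolongation_topology_def)
      have wg: "Comp C w g \<in> Hom C x q"
        using Comp_in_Hom[OF g w(1)] .
      have id: "Ident C q \<in> Hom C q q"
        using Ident_in_Hom q P(1) by blast
      have "pullback C (Comp C w g) T \<in> ?J q"
        using cov S' Cod_Hom[OF wg] by metis
      \<comment> \<open>As \<open>q\<close> lies in \<open>P\<close>, the covering condition at
        \<open>q\<close> applies to its identity and supplies a second prolongation
        \<open>v\<close>, to be composed with \<open>w\<close>.\<close>
      then obtain r v where r: "r \<in> P" and v: "v \<in> Hom C q r"
        and T': "Comp C v (Ident C q) \<in> pullback C (Comp C w g) T"
        using q id by (fastforce simp: prolongation_topology_def)
      have "Comp C v (Comp C w g) \<in> T"
        using T' mem_pullback[OF wg v] Comp_Ident_right[OF v] by simp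
      then have "Comp C (Comp C v w) g \<in> T"
        using Comp_assoc[OF g w(1) v] by simp
      moreover have "\<not> isomorphism C p r (Comp C v w)"
        using directed_comp_isomorphismD(1)[OF dir fin w(1) v] w(2) by blast
      ultimately show ?thesis using r Comp_in_Hom[OF w(1) v] by blast
    qed
    then show ?thesis using T by (simp add: prolongation_topology_def)
  qed
  show ?thesis
    unfolding grothendieck_topology_def
  proof (intro conjI ballI allI impI)
    show "subfunctor C x S" if "S \<in> ?J x" for x S
      using that by (simp add: prolongation_topology_def)
  qed (use max pull trans in blast)+
qed

lemma prolongation_topology_no_irreducible:
  assumes dir: "directed_category C" and fin: "\<forall>x \<in> Ob C. finite (Hom C x x)"
    and P: "\<And>p. p \<in> P \<Longrightarrow> \<exists>q \<in> P. \<exists>w \<in> Hom C p q. \<not> isomorphism C p q w"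
  shows "\<not> irreducible_ob C (prolongation_topology C P) z"
proof
  interpret category C using dir by (simp add: directed_category_def)
  assume irr: "irreducible_ob C (prolongation_topology C P) z"
  then have z: "z \<in> Ob C" by (simp add: irreducible_ob_def)
  \<comment> \<open>The ideal property enters on both sides: a non-isomorphic first factor makes
    \<open>S\<close> a sieve, a non-isomorphic second factor makes it cover.\<close>
  define S where "S = {f \<in> Hom_from C z. \<not> isomorphism C z (Cod C f) f}"
  have "Comp C g f \<in> S" if "f \<in> S" "g \<in> Hom_from C (Cod C f)" for f g
  proof -
    have f: "f \<in> Hom C z (Cod C f)" "\<not> isomorphism C z (Cod C f) f"
      and g: "g \<in> Hom C (Cod C f) (Cod C g)"
      using that Hom_from_eq[of f z] Hom_from_eq[of g] by (auto simp: S_def)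
    have gf: "Comp C g f \<in> Hom C z (Cod C g)"
      using Comp_in_Hom[OF f(1) g] .
    then show ?thesis
      using directed_comp_isomorphismD(1)[OF dir fin f(1) g] f(2) Cod_Hom[OF gf] Hom_imp_Hom_from[OF gf]
      by (auto simp: S_def)
  qed
  then have "subfunctor C z S"
    by (auto simp: subfunctor_def S_def)
  moreover have "\<exists>q \<in> P. \<exists>w \<in> Hom C p q. \<not> isomorphism C p q w \<and> Comp C w g \<in> S"
    if p: "p \<in> P" and g: "g \<in> Hom C z p" for p g
  proof -
    obtain q w where q: "q \<in> P" and w: "w \<in> Hom C p q" "\<not> isomorphism C p q w"
      using P[OF p] by blast
    have wg: "Comp C w g \<in> Hom C z q"
      using Comp_in_Hom[OF g w(1)] .
    then have "Comp C w g \<in> S"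
      using directed_comp_isomorphismD(2)[OF dir fin g w(1)] w(2) Cod_Hom[OF wg] Hom_imp_Hom_from[OF wg]
      by (auto simp: S_def)
    then show ?thesis using q w by blast
  qed
  ultimately have "S \<in> prolongation_topology C P z"
    by (simp add: prolongation_topology_def)
  then have "S = Hom_from C z"
    using irr by (simp add: irreducible_ob_def)
  then have "Ident C z \<in> S"
    using Ident_in_Hom[OF z] Hom_imp_Hom_from by blast
  then show False
    using isomorphism_Ident[OF z] Cod_Hom[OF Ident_in_Hom[OF z]] by (simp add: S_def)
qed

text \<open>With no irreducible objects every irreducible sieve is empty, and the identity of a
  member of \<open>P\<close> has no prolongation into the empty sieve.\<close>

lemma not_rigid_prolongation_topology:
  assumes dir: "directed_category C" and fin: "\<forall>x \<in> Ob C. finite (Hom C x x)"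
    and P: "P \<subseteq> Ob C" "P \<noteq> {}"
      "\<And>p. p \<in> P \<Longrightarrow> \<exists>q \<in> P. \<exists>w \<in> Hom C p q. \<not> isomorphism C p q w"
  shows "\<not> rigid C (prolongation_topology C P)"
proof
  interpret category C using dir by (simp add: directed_category_def)
  let ?J = "prolongation_topology C P"
  assume rigid: "rigid C ?J"
  obtain p where p: "p \<in> P" "p \<in> Ob C" using P(1,2) by blast
  have "\<not> irreducible_ob C ?J z" for z
    using prolongation_topology_no_irreducible[OF dir fin P(3)] .
  then have "irreducible_sieve C ?J p = {}"
    by (simp add: irreducible_sieve_def)
  then have "{} \<in> ?J p"
    using rigid p(2) by (auto simp: rigid_def)
  then show False
    using p Ident_in_Hom[OF p(2)] by (auto simp: prolongation_topology_def)
qed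

section \<open>The set \<open>P\<close> from a failure of noetherian EI\<close>

lemma not_noetherian_EI_nonisomorphism_closed:
  assumes dir: "directed_category C" and nN: "\<not> noetherian_EI C"
  obtains P where "P \<subseteq> Ob C" "P \<noteq> {}"
    "\<And>p. p \<in> P \<Longrightarrow> \<exists>q \<in> P. \<exists>w \<in> Hom C p q. \<not> isomorphism C p q w"
proof (cases "EI C")
  case False
  then obtain x f where "x \<in> Ob C" "f \<in> Hom C x x" "\<not> isomorphism C x x f"
    by (auto simp: EI_def)
  then show thesis by (intro that[of "{x}"]) auto
next
  case True
  then obtain c :: "nat \<Rightarrow> _" where c: "\<And>n. c n \<in> Ob C" "\<And>n. (c n, c (Suc n)) \<in> ob_le C"
    and ns: "\<And>N. \<exists>n\<ge>N. c n \<noteq> c N"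
    using nN unfolding noetherian_EI_def ascending_chain_condition_def by blast
  have po: "refl_on (Ob C) (ob_le C)" "trans (ob_le C)"
    using dir by (auto simp: directed_category_def partial_order_on_def preorder_on_def)
  have mono: "(c n, c m) \<in> ob_le C" if "n \<le> m" for n m
    using that
  proof (induction m rule: dec_induct)
    case base
    show ?case using po(1) c(1) by (simp add: refl_onD)
  next
    case (step m)
    then show ?case using po(2) c(2) by (blast dest: transD)
  qed
  have "\<exists>q \<in> range c. \<exists>w \<in> Hom C (c n) q. \<not> isomorphism C (c n) q w" for n
  proof -
    \<comment> \<open>The chain may pause at \<open>c n\<close>, so \<open>Suc n\<close> need not
      serve as \<open>m\<close>. Once the objects differ, skeletality makes every morphism between
      them a non-isomorphism.\<close>
    obtain m where m: "m \<ge> n" "c m \<noteq> c n" using ns by blast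
    then obtain w where "w \<in> Hom C (c n) (c m)"
      using mono by (auto simp: ob_le_def)
    moreover have "\<not> isomorphism C (c n) (c m) w"
      using dir m(2) c(1) unfolding directed_category_def skeletal_def by metis
    ultimately show ?thesis by blast
  qed
  then show thesis using c(1) by (intro that[of "range c"]) auto
qed

theorem theorem1p4:
  fixes C :: "('o, 'm) small_cat"
  assumes "directed_category C"
    and "\<forall>x \<in> Ob C. finite (Hom C x x)"
  shows "(\<forall>J. grothendieck_topology C J \<longrightarrow> rigid C J) \<longleftrightarrow> noetherian_EI C"
proof
  assume rigid: "\<forall>J. grothendieck_topology C J \<longrightarrow> rigid C J"
  show "noetherian_EI C"
  proof (rule ccontr)
    assume "\<not> noetherian_EI C"
    then obtain P where P: "P \<subseteq> Ob C" "P \<noteq> {}"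
      "\<And>p. p \<in> P \<Longrightarrow> \<exists>q \<in> P. \<exists>w \<in> Hom C p q. \<not> isomorphism C p q w"
      using not_noetherian_EI_nonisomorphism_closed[OF assms(1)] by metis
    show False
      using rigid grothendieck_topology_prolongation[OF assms P(1,3)]
        not_rigid_prolongation_topology[OF assms P] by blast
  qed
next
  assume "noetherian_EI C"
  then show "\<forall>J. grothendieck_topology C J \<longrightarrow> rigid C J"
    using assms(1) category.rigid_of_noetherian_EI by (auto simp: directed_category_def)
qed

end
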